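(* Let $X$ be a geodesic metric space with $\operatorname{asdim}X=n$, where $2\le n<\infty$. If $X$ contains at least one infinite geodesic and has uniformly coarse connected spheres, then $X$ contains an $n$-asymptotic Cantor manifold, i.e. there is a subset of $X$ which, with the restricted metric, is an $n$-asymptotic Cantor manifold.
   Context: Asymptotic dimension: for a metric space $X$ and an integer $n\ge 0$, $\operatorname{asdim} X\le n$ iff for every $R>0$ there is a uniformly bounded covering $\mathcal U$ of $X$ (i.e. $\sup_{U\in\mathcal U}\operatorname{diam}U<\infty$) such that every ball of radius $R$ in $X$ intersects at most $n+1$ elements of $\mathcal U$. Subsets carry the restricted metric. For $A\subseteq X$, $N_R(A)$ is the set of points of $X$ at distance at most $R$ from $A$. $X$ has uniformly coarse connected spheres if there exists $R>0$ such that for every sphere $\{y\in X: d(x,y)=r\}$ in $X$, the $R$-neighbourhood of (the union of the connected components of) the sphere is connected. An infinite geodesic is an isometrically embedded ray $[0,\infty)\to X$. Coarse separation: let $X$ be a metric space and $K\subseteq X$. A component $C$ of $X\setminus N_R(K)$ is deep if $C$ is not contained in $N_{R'}(K)$ for any $R'>0$. The set $K$ coarsely separates $X$ if there is an $R>0$ such that $X\setminus N_R(K)$ has at least two deep connected components. Asymptotic Cantor manifold: a connected metric space $X$ with $\operatorname{asdim}X=n$, $n\ge 2$, is an $n$-asymptotic Cantor manifold if $X$ cannot be coarsely separated by any subset of asymptotic dimension $k$ with $k\le n-2$. *)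

theory Defs
  imports "HOL-Analysis.Analysis" "HOL-Library.Extended_Nat"
begin

text \<open>
  A metric space is a subset \<open>X\<close> of some type of class \<^class>\<open>metric_space\<close>, equipped with the
  restricted metric; all notions below are relative to \<open>X\<close>.
\<close>

text \<open>The library's \<^const>\<open>diameter\<close> has no meaningful value on unbounded sets, so the diameter
  bound is written out pointwise.\<close>

definition uniformly_bounded :: "'a::metric_space set set \<Rightarrow> bool" where
  "uniformly_bounded \<U> \<longleftrightarrow> (\<exists>D. \<forall>U\<in>\<U>. \<forall>x\<in>U. \<forall>y\<in>U. dist x y \<le> D)"

definition asdim_le :: "'a::metric_space set \<Rightarrow> nat \<Rightarrow> bool" where
  "asdim_le X n \<longleftrightarrow>
     (\<forall>R>0. \<exists>\<U>. \<Union>\<U> = X \<and> uniformly_bounded \<U> \<and>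
        (\<forall>x\<in>X. finite {U\<in>\<U>. U \<inter> ball x R \<noteq> {}} \<and> card {U\<in>\<U>. U \<inter> ball x R \<noteq> {}} \<le> n + 1))"

text \<open>The infimum of the empty set is \<open>\<infinity>\<close>. The empty set gets dimension \<open>0\<close>.\<close>

definition asdim :: "'a::metric_space set \<Rightarrow> enat" where
  "asdim X = (INF n\<in>{n. asdim_le X n}. enat n)"

text \<open>The condition \<open>A \<noteq> {}\<close> is needed because \<open>infdist x {} = 0\<close> by convention,
  whereas no point is at finite distance from the empty set.\<close>

definition nbhd_in :: "'a::metric_space set \<Rightarrow> real \<Rightarrow> 'a set \<Rightarrow> 'a set" where
  "nbhd_in X R A = {x\<in>X. A \<noteq> {} \<and> infdist x A \<le> R}"

definition isometric_on :: "real set \<Rightarrow> (real \<Rightarrow> 'a::metric_space) \<Rightarrow> bool" where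
  "isometric_on S g \<longleftrightarrow> (\<forall>s\<in>S. \<forall>t\<in>S. dist (g s) (g t) = dist s t)"

definition geodesic_space :: "'a::metric_space set \<Rightarrow> bool" where
  "geodesic_space X \<longleftrightarrow>
     (\<forall>x\<in>X. \<forall>y\<in>X. \<exists>g. g 0 = x \<and> g (dist x y) = y \<and>
        g ` {0..dist x y} \<subseteq> X \<and> isometric_on {0..dist x y} g)"

definition has_infinite_geodesic :: "'a::metric_space set \<Rightarrow> bool" where
  "has_infinite_geodesic X \<longleftrightarrow> (\<exists>g. g ` {0..} \<subseteq> X \<and> isometric_on {0..} g)"

definition uniformly_coarse_connected_spheres :: "'a::metric_space set \<Rightarrow> bool" where
  "uniformly_coarse_connected_spheres X \<longleftrightarrow>
     (\<exists>R>0. \<forall>x\<in>X. \<forall>r\<ge>0. connected (nbhd_in X R (X \<inter> sphere x r)))"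

definition deep :: "'a::metric_space set \<Rightarrow> 'a set \<Rightarrow> 'a set \<Rightarrow> bool" where
  "deep X K C \<longleftrightarrow> (\<forall>R>0. \<not> C \<subseteq> nbhd_in X R K)"

definition coarsely_separates :: "'a::metric_space set \<Rightarrow> 'a set \<Rightarrow> bool" where
  "coarsely_separates X K \<longleftrightarrow>
     (\<exists>R>0. \<exists>C\<in>components (X - nbhd_in X R K). \<exists>D\<in>components (X - nbhd_in X R K).
        C \<noteq> D \<and> deep X K C \<and> deep X K D)"

definition asymptotic_Cantor_manifold :: "nat \<Rightarrow> 'a::metric_space set \<Rightarrow> bool" where
  "asymptotic_Cantor_manifold n X \<longleftrightarrow>
     connected X \<and> n \<ge> 2 \<and> asdim X = enat n \<and>
     (\<forall>K\<subseteq>X. asdim K \<le> enat (n - 2) \<longrightarrow> \<not> coarsely_separates X K)"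

end

theory Submission
  imports Defs
begin

text \<open>
  Alternating annuli about the origin of the infinite geodesic cover \<open>X\<close> by two sets, so by the
  union theorem for asymptotic dimension one of the two, \<open>E\<close> say, has dimension \<open>n\<close>. Let \<open>Y\<close> consist
  of \<open>E\<close>, of the connected neighbourhoods of the inner spheres of its annuli, and of the infinite
  geodesic. In each gap between consecutive annuli, \<open>Y\<close> is just a segment of the geodesic, so any
  unbounded connected subset of \<open>Y\<close> contains almost all of these segments. A deep component is
  unbounded, so two deep components meet: no set whatsoever coarsely separates \<open>Y\<close>.
\<close>

section \<open>Asymptotic dimension\<close>

lemma asdim_le_mono:
  assumes "asdim_le X m" "m \<le> n"
  shows "asdim_le X n"
  unfolding asdim_le_def
proof (intro allI impI)
  fix R :: real assume "R > 0"
  then obtain \<U> where \<U>: "\<Union>\<U> = X" "uniformly_bounded \<U>"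
    "\<And>x. x \<in> X \<Longrightarrow> finite {U\<in>\<U>. U \<inter> ball x R \<noteq> {}} \<and> card {U\<in>\<U>. U \<inter> ball x R \<noteq> {}} \<le> m + 1"
    using assms(1) unfolding asdim_le_def by meson
  have "card {U\<in>\<U>. U \<inter> ball x R \<noteq> {}} \<le> n + 1" if "x \<in> X" for x
    using \<U>(3)[OF that] assms(2) by linarith
  with \<U> show "\<exists>\<U>. \<Union>\<U> = X \<and> uniformly_bounded \<U> \<and>
        (\<forall>x\<in>X. finite {U\<in>\<U>. U \<inter> ball x R \<noteq> {}} \<and> card {U\<in>\<U>. U \<inter> ball x R \<noteq> {}} \<le> n + 1)"
    by blast
qed

lemma asdim_le_subset:
  assumes "asdim_le X n" "Y \<subseteq> X"
  shows "asdim_le Y n"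
  unfolding asdim_le_def
proof (intro allI impI)
  fix R :: real assume "R > 0"
  then obtain \<U> where \<U>: "\<Union>\<U> = X" "uniformly_bounded \<U>"
    "\<And>x. x \<in> X \<Longrightarrow> finite {U\<in>\<U>. U \<inter> ball x R \<noteq> {}} \<and> card {U\<in>\<U>. U \<inter> ball x R \<noteq> {}} \<le> n + 1"
    using assms(1) unfolding asdim_le_def by meson
  \<comment> \<open>Distinct cover elements may have the same trace on \<open>Y\<close>, which can
    only lower the number of elements meeting a ball.\<close>
  let ?\<V> = "(\<lambda>U. U \<inter> Y) ` \<U>"
  have "\<Union>?\<V> = Y"
    using \<U>(1) assms(2) by auto
  moreover have "uniformly_bounded ?\<V>"
    using \<U>(2) unfolding uniformly_bounded_def by fastforce
  moreover have "finite {V\<in>?\<V>. V \<inter> ball x R \<noteq> {}} \<and> card {V\<in>?\<V>. V \<inter> ball x R \<noteq> {}} \<le> n + 1"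
    if "x \<in> Y" for x
  proof -
    have fin: "finite {U\<in>\<U>. U \<inter> ball x R \<noteq> {}}" and le: "card {U\<in>\<U>. U \<inter> ball x R \<noteq> {}} \<le> n + 1"
      using \<U>(3) that assms(2) by auto
    have sub: "{V\<in>?\<V>. V \<inter> ball x R \<noteq> {}} \<subseteq> (\<lambda>U. U \<inter> Y) ` {U\<in>\<U>. U \<inter> ball x R \<noteq> {}}"
      by auto
    have "card {V\<in>?\<V>. V \<inter> ball x R \<noteq> {}} \<le> card ((\<lambda>U. U \<inter> Y) ` {U\<in>\<U>. U \<inter> ball x R \<noteq> {}})"
      using sub fin by (intro card_mono) auto
    also have "\<dots> \<le> card {U\<in>\<U>. U \<inter> ball x R \<noteq> {}}"
      by (rule card_image_le[OF fin])
    finally show ?thesis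
      using le finite_subset[OF sub] fin by auto
  qed
  ultimately show "\<exists>\<U>. \<Union>\<U> = Y \<and> uniformly_bounded \<U> \<and>
        (\<forall>x\<in>Y. finite {U\<in>\<U>. U \<inter> ball x R \<noteq> {}} \<and> card {U\<in>\<U>. U \<inter> ball x R \<noteq> {}} \<le> n + 1)"
    by blast
qed

text \<open>The admissible bounds are upward closed and their infimum, once finite, is attained. The
  successor form turns the value into two statements about \<open>asdim_le\<close>, without
  subtraction on naturals.\<close>

lemma asdim_eq_Suc_iff: "asdim X = enat (Suc m) \<longleftrightarrow> asdim_le X (Suc m) \<and> \<not> asdim_le X m"
proof
  assume eq: "asdim X = enat (Suc m)"
  let ?S = "enat ` {n. asdim_le X n}"
  have Inf: "Inf ?S = enat (Suc m)"
    using eq by (simp add: asdim_def)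
  have "?S \<noteq> {}"
  proof
    assume "?S = {}"
    with Inf show False
      by (metis Inf_empty enat.distinct(1) top_enat_def)
  qed
  then have "Inf ?S \<in> ?S"
    unfolding Inf_enat_def by (auto intro: LeastI)
  then have 1: "asdim_le X (Suc m)"
    unfolding Inf by auto
  have "\<not> asdim_le X m"
  proof
    assume "asdim_le X m"
    then have "Inf ?S \<le> enat m"
      by (intro Inf_lower) auto
    with Inf show False by simp
  qed
  with 1 show "asdim_le X (Suc m) \<and> \<not> asdim_le X m" ..
next
  assume *: "asdim_le X (Suc m) \<and> \<not> asdim_le X m"
  show "asdim X = enat (Suc m)"
    unfolding asdim_def
  proof (rule antisym)
    show "(INF n\<in>{n. asdim_le X n}. enat n) \<le> enat (Suc m)"
      using * by (intro INF_lower) auto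
    show "enat (Suc m) \<le> (INF n\<in>{n. asdim_le X n}. enat n)"
    proof (rule INF_greatest)
      fix n assume "n \<in> {n. asdim_le X n}"
      then have "\<not> n \<le> m"
        using * asdim_le_mono by auto
      then show "enat (Suc m) \<le> enat n" by simp
    qed
  qed
qed

section \<open>Coloured covers and the union theorem\<close>

text \<open>These are the \<open>r\<close>-disjoint, \<open>D\<close>-bounded families. Covers by
  \<open>n + 1\<close> of them at every scale \<open>r\<close> are the colouring form of dimension
  at most \<open>n\<close>, in which unions can be treated one colour at a time.\<close>

definition separated_family :: "real \<Rightarrow> real \<Rightarrow> 'a::metric_space set set \<Rightarrow> bool" where
  "separated_family r D \<U> \<longleftrightarrow>
     (\<forall>U\<in>\<U>. \<forall>V\<in>\<U>. U \<noteq> V \<longrightarrow> (\<forall>x\<in>U. \<forall>y\<in>V. r \<le> dist x y)) \<and>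
     (\<forall>U\<in>\<U>. \<forall>x\<in>U. \<forall>y\<in>U. dist x y \<le> D)"

lemma separated_familyD:
  assumes "separated_family r D \<U>"
  shows "U \<in> \<U> \<Longrightarrow> V \<in> \<U> \<Longrightarrow> U \<noteq> V \<Longrightarrow> x \<in> U \<Longrightarrow> y \<in> V \<Longrightarrow> r \<le> dist x y"
    and "U \<in> \<U> \<Longrightarrow> x \<in> U \<Longrightarrow> y \<in> U \<Longrightarrow> dist x y \<le> D"
proof -
  show "r \<le> dist x y" if "U \<in> \<U>" "V \<in> \<U>" "U \<noteq> V" "x \<in> U" "y \<in> V"
    using assms[unfolded separated_family_def, THEN conjunct1] that by simp
  show "dist x y \<le> D" if "U \<in> \<U>" "x \<in> U" "y \<in> U"
    using assms[unfolded separated_family_def, THEN conjunct2] that by simp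
qed

text \<open>Pigeonhole: \<open>n + 1\<close> strict inclusions starting from a nonempty set would
  give \<open>S (Suc n)\<close> at least \<open>n + 2\<close> elements.\<close>

lemma chain_stabilises:
  fixes S :: "nat \<Rightarrow> 'b set"
  assumes mono: "\<And>j. S j \<subseteq> S (Suc j)" and "S 0 \<noteq> {}"
    and fin: "finite (S (Suc n))" and card: "card (S (Suc n)) \<le> Suc n"
  shows "\<exists>j\<le>n. S j = S (Suc j)"
proof (rule ccontr)
  assume "\<not> ?thesis"
  then have ne: "S j \<noteq> S (Suc j)" if "j \<le> n" for j
    using that by blast
  have sub: "S j \<subseteq> S (Suc n)" if "j \<le> Suc n" for j
    using lift_Suc_mono_le[of S, OF mono that] .
  have "Suc j \<le> card (S j)" if "j \<le> Suc n" for j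
    using that
  proof (induction j)
    case 0
    have "finite (S 0)" using sub[of 0] fin finite_subset by auto
    with \<open>S 0 \<noteq> {}\<close> show ?case by (simp add: Suc_le_eq card_gt_0_iff)
  next
    case (Suc j)
    have "finite (S (Suc j))" using sub[OF Suc.prems] fin finite_subset by auto
    then have "card (S j) < card (S (Suc j))"
      using mono[of j] ne[of j] Suc.prems by (intro psubset_card_mono) auto
    with Suc show ?case by linarith
  qed
  from this[of "Suc n"] card show False by simp
qed

text \<open>
  A point is labelled by the set \<open>\<sigma>\<close> of the cover elements within distance \<open>j r\<close>, where \<open>j \<le> n\<close> is
  chosen so that no further element lies within distance \<open>(j + 1) r\<close>, and coloured by the cardinality
  of \<open>\<sigma>\<close>. Two different labels of the same cardinality are not nested; comparing the distances
  to one element of each difference shows that the points are at least \<open>r\<close> apart.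
\<close>

lemma asdim_le_imp_coloured:
  fixes X :: "'a::metric_space set"
  assumes "asdim_le X n" and r: "r > 0"
  obtains D \<W> where "(\<Union>i\<le>n. \<Union>(\<W> i)) = X" "\<And>i. i \<le> n \<Longrightarrow> separated_family r D (\<W> i)"
proof -
  \<comment> \<open>The labels use radii up to \<open>(n + 1) r\<close>. One more step makes every
    element within that distance actually meet the open ball of radius \<open>L\<close>.\<close>
  define L where "L = real (n + 2) * r"
  have "L > 0" using r by (simp add: L_def)
  then obtain \<U> where \<U>: "\<Union>\<U> = X" "uniformly_bounded \<U>"
    "\<And>x. x \<in> X \<Longrightarrow> finite {U\<in>\<U>. U \<inter> ball x L \<noteq> {}} \<and> card {U\<in>\<U>. U \<inter> ball x L \<noteq> {}} \<le> n + 1"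
    using assms(1) unfolding asdim_le_def by meson
  obtain B where B: "\<And>U x y. U \<in> \<U> \<Longrightarrow> x \<in> U \<Longrightarrow> y \<in> U \<Longrightarrow> dist x y \<le> B"
    using \<U>(2) unfolding uniformly_bounded_def by blast
  \<comment> \<open>The empty set is excluded because \<open>infdist x {} = 0\<close> would put it
    next to every point.\<close>
  define S where "S x j = {U\<in>\<U>. U \<noteq> {} \<and> infdist x U \<le> real j * r}" for x j
  have near: "\<exists>u\<in>U. dist x u < t" if "U \<noteq> {}" "infdist x U < t" for x :: 'a and U and t :: real
    using that by (metis infdist_notempty cINF_less_iff bdd_below_image_dist)
  have meets: "S x j \<subseteq> {U\<in>\<U>. U \<inter> ball x L \<noteq> {}}" if "j \<le> Suc n" for x j
  proof
    fix U assume U: "U \<in> S x j"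
    have "real j * r \<le> real (Suc n) * r" using that r by (intro mult_right_mono) auto
    also have "\<dots> < L" using r by (simp add: L_def)
    finally have "infdist x U < L" using U by (auto simp: S_def)
    moreover have "U \<noteq> {}" using U by (simp add: S_def)
    ultimately obtain u where "u \<in> U" "dist x u < L" using near by blast
    then show "U \<in> {U\<in>\<U>. U \<inter> ball x L \<noteq> {}}" using U by (auto simp: S_def)
  qed
  have ex: "\<exists>j\<le>n. S x j = S x (Suc j)" if x: "x \<in> X" for x
  proof (rule chain_stabilises)
    show "S x j \<subseteq> S x (Suc j)" for j
    proof -
      have "real j * r \<le> real (Suc j) * r" using r by (intro mult_right_mono) auto
      then show ?thesis unfolding S_def by (auto intro: order_trans)
    qed
    obtain U where "U \<in> \<U>" "x \<in> U" using \<U>(1) x by blast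
    then show "S x 0 \<noteq> {}" unfolding S_def by (auto intro!: exI[of _ U])
    note sub = meets[OF order_refl, of x]
    show "finite (S x (Suc n))" using sub \<U>(3)[OF that] finite_subset by blast
    show "card (S x (Suc n)) \<le> Suc n" using card_mono[OF _ sub] \<U>(3)[OF that] by linarith
  qed
  define k where "k x = (SOME j. j \<le> n \<and> S x j = S x (Suc j))" for x
  have k: "k x \<le> n" "S x (k x) = S x (Suc (k x))" if "x \<in> X" for x
    using someI_ex[OF ex[OF that]] unfolding k_def by auto
  define \<sigma> where "\<sigma> x = S x (k x)" for x
  \<comment> \<open>Stabilisation at \<open>k x\<close>: members of the label lie within
    \<open>k x * r\<close>, all other nonempty cover elements lie beyond
    \<open>(k x + 1) * r\<close>.\<close>
  have gap: "infdist x U + r \<le> infdist x V"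
    if "x \<in> X" "U \<in> \<sigma> x" "V \<in> \<U>" "V \<noteq> {}" "V \<notin> \<sigma> x" for x U V
  proof -
    have "infdist x U \<le> real (k x) * r" using that(2) by (simp add: \<sigma>_def S_def)
    moreover have "V \<notin> S x (Suc (k x))" using that(5) k(2)[OF that(1)] by (simp add: \<sigma>_def)
    then have "real (Suc (k x)) * r < infdist x V" using that(3,4) by (auto simp: S_def)
    ultimately show ?thesis by (simp add: algebra_simps)
  qed
  have \<sigma>_fin: "finite (\<sigma> x)" "\<sigma> x \<noteq> {}" "card (\<sigma> x) \<le> Suc n" if x: "x \<in> X" for x
  proof -
    have sub: "\<sigma> x \<subseteq> {U\<in>\<U>. U \<inter> ball x L \<noteq> {}}"
      unfolding \<sigma>_def using meets[of "k x" x] k(1)[OF x] by simp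
    show "finite (\<sigma> x)" using sub \<U>(3)[OF that] finite_subset by blast
    show "card (\<sigma> x) \<le> Suc n" using card_mono[OF _ sub] \<U>(3)[OF that] by linarith
    obtain U where "U \<in> \<U>" "x \<in> U" using \<U>(1) x by blast
    then have "U \<in> \<sigma> x" unfolding \<sigma>_def S_def using r by auto
    then show "\<sigma> x \<noteq> {}" by blast
  qed
  \<comment> \<open>Labels have between \<open>1\<close> and \<open>n + 1\<close> elements, so the
    shift to \<open>Suc i\<close> makes the colours run over \<open>0..n\<close>.\<close>
  define \<W> where "\<W> i = (\<lambda>s. {x\<in>X. \<sigma> x = s}) ` {s. card s = Suc i}" for i
  show thesis
  proof (rule that)
    show "(\<Union>i\<le>n. \<Union>(\<W> i)) = X"
    proof (intro equalityI subsetI)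
      fix x assume x: "x \<in> X"
      have "card (\<sigma> x) \<noteq> 0" using \<sigma>_fin[OF x] by simp
      then obtain i where i: "card (\<sigma> x) = Suc i" using not0_implies_Suc by blast
      with \<sigma>_fin(3)[OF x] have "i \<le> n" by simp
      moreover have "x \<in> \<Union>(\<W> i)" using x i by (auto simp: \<W>_def)
      ultimately show "x \<in> (\<Union>i\<le>n. \<Union>(\<W> i))" by blast
    qed (auto simp: \<W>_def)
  next
    fix i
    \<comment> \<open>Points with the same label are both within \<open>L\<close> of a common cover
      element, whose diameter is at most \<open>B\<close>.\<close>
    show "separated_family r (B + 2 * L) (\<W> i)"
      unfolding separated_family_def
    proof (intro conjI ballI impI)
      fix P Q x y assume PQ: "P \<in> \<W> i" "Q \<in> \<W> i" "P \<noteq> Q" and xy: "x \<in> P" "y \<in> Q"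
      have x: "x \<in> X" "card (\<sigma> x) = Suc i" and y: "y \<in> X" "card (\<sigma> y) = Suc i"
        and ne: "\<sigma> x \<noteq> \<sigma> y"
        using PQ xy by (auto simp: \<W>_def)
      have "\<not> \<sigma> x \<subseteq> \<sigma> y"
        using card_subset_eq[OF \<sigma>_fin(1)[OF y(1)], of "\<sigma> x"] x y ne by auto
      then obtain U where U: "U \<in> \<sigma> x" "U \<notin> \<sigma> y" by blast
      have "\<not> \<sigma> y \<subseteq> \<sigma> x"
        using card_subset_eq[OF \<sigma>_fin(1)[OF x(1)], of "\<sigma> y"] x y ne by auto
      then obtain V where V: "V \<in> \<sigma> y" "V \<notin> \<sigma> x" by blast
      have "U \<in> \<U>" "U \<noteq> {}" "V \<in> \<U>" "V \<noteq> {}"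
        using U(1) V(1) by (auto simp: \<sigma>_def S_def)
      \<comment> \<open>In the sum of these two inequalities and the next two, the distances to
        \<open>U\<close> and \<open>V\<close> cancel and \<open>2 * r \<le> 2 * dist x y\<close>
        remains.\<close>
      then have "infdist x U + r \<le> infdist x V" "infdist y V + r \<le> infdist y U"
        using gap x(1) y(1) U V by blast+
      moreover have "infdist x V \<le> infdist y V + dist x y" "infdist y U \<le> infdist x U + dist y x"
        by (rule infdist_triangle)+
      ultimately show "r \<le> dist x y" by (simp add: dist_commute)
    next
      fix P x y assume P: "P \<in> \<W> i" and xy: "x \<in> P" "y \<in> P"
      have x: "x \<in> X" and y: "y \<in> X" and eq: "\<sigma> x = \<sigma> y"
        using P xy by (auto simp: \<W>_def)
      obtain U where U: "U \<in> \<sigma> x" "U \<in> \<sigma> y" using \<sigma>_fin(2)[OF x] eq by blast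
      have UU: "U \<in> \<U>" using U by (auto simp: \<sigma>_def S_def)
      have "U \<inter> ball x L \<noteq> {}" "U \<inter> ball y L \<noteq> {}"
        using U meets[of "k x" x] meets[of "k y" y] k(1)[OF x] k(1)[OF y] by (auto simp: \<sigma>_def)
      then obtain u v where "u \<in> U" "dist x u < L" "v \<in> U" "dist y v < L" by auto
      moreover have "dist u v \<le> B" using B UU calculation by blast
      moreover have "dist x y \<le> dist x u + dist u v + dist y v"
        using dist_triangle[of x y u] dist_triangle[of u y v] by (simp add: dist_commute)
      ultimately show "dist x y \<le> B + 2 * L" by linarith
    qed
  qed
qed

text \<open>Two points of a ball of radius \<open>R\<close> are less than \<open>2 * R\<close>
  apart, so at separation \<open>2 * R\<close> each of the \<open>n + 1\<close> colours contributes
  at most one member meeting the ball.\<close>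

lemma coloured_imp_asdim_le:
  fixes X :: "'a::metric_space set"
  assumes "\<And>r. r > 0 \<Longrightarrow> \<exists>D \<W>. (\<Union>i\<le>n. \<Union>(\<W> i)) = X \<and> (\<forall>i\<le>n. separated_family r D (\<W> i))"
  shows "asdim_le X n"
  unfolding asdim_le_def
proof (intro allI impI)
  fix R :: real assume "R > 0"
  then obtain D \<W> where cover: "(\<Union>i\<le>n. \<Union>(\<W> i)) = X"
    and sep: "\<And>i. i \<le> n \<Longrightarrow> separated_family (2 * R) D (\<W> i)"
    using assms[of "2 * R"] by auto
  let ?\<U> = "\<Union>i\<le>n. \<W> i"
  have union: "\<Union>?\<U> = X" using cover by blast
  have bdd: "uniformly_bounded ?\<U>"
    unfolding uniformly_bounded_def using separated_familyD(2)[OF sep] by (intro exI[of _ D]) auto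
  have mult: "finite {U\<in>?\<U>. U \<inter> ball x R \<noteq> {}} \<and> card {U\<in>?\<U>. U \<inter> ball x R \<noteq> {}} \<le> n + 1"
    for x
  proof -
    let ?F = "\<lambda>i. {U\<in>\<W> i. U \<inter> ball x R \<noteq> {}}"
    have single: "U = V" if "i \<le> n" "U \<in> ?F i" "V \<in> ?F i" for i U V
    proof (rule ccontr)
      assume "U \<noteq> V"
      obtain u v where uv: "u \<in> U" "dist x u < R" "v \<in> V" "dist x v < R"
        using \<open>U \<in> ?F i\<close> \<open>V \<in> ?F i\<close> by auto
      then have "2 * R \<le> dist u v"
        using separated_familyD(1)[OF sep[OF \<open>i \<le> n\<close>], of U V u v] \<open>U \<noteq> V\<close> that by blast
      also have "\<dots> \<le> dist x u + dist x v"
        by (metis dist_commute dist_triangle)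
      finally show False using uv by linarith
    qed
    have fin: "finite (?F i)" and one: "card (?F i) \<le> 1" if i: "i \<le> n" for i
    proof -
      obtain V where V: "?F i \<subseteq> {V}"
      proof (cases "?F i = {}")
        case True
        show thesis by (rule that[of "{}"]) (simp only: True empty_subsetI)
      next
        case False
        then obtain V where "V \<in> ?F i" by blast
        then have "?F i \<subseteq> {V}"
          using single[OF i] by (intro subsetI) (simp only: singleton_iff)
        then show thesis by (rule that)
      qed
      show "finite (?F i)" by (rule finite_subset[OF V]) simp
      show "card (?F i) \<le> 1" using card_mono[OF _ V] by simp
    qed
    have eq: "{U\<in>?\<U>. U \<inter> ball x R \<noteq> {}} = (\<Union>i\<le>n. ?F i)" by blast
    have "card (\<Union>i\<le>n. ?F i) \<le> (\<Sum>i\<le>n. card (?F i))" by (rule card_UN_le) simp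
    also have "\<dots> \<le> (\<Sum>i\<le>n. 1)" using one by (intro sum_mono) auto
    finally show ?thesis unfolding eq using fin by auto
  qed
  show "\<exists>\<U>. \<Union>\<U> = X \<and> uniformly_bounded \<U> \<and>
        (\<forall>x\<in>X. finite {U\<in>\<U>. U \<inter> ball x R \<noteq> {}} \<and> card {U\<in>\<U>. U \<inter> ball x R \<noteq> {}} \<le> n + 1)"
    by (intro exI[of _ ?\<U>] conjI[OF union] conjI[OF bdd] ballI mult)
qed

text \<open>Every element of the coarser family absorbs the elements of the finer one that come close to it.\<close>

lemma separated_family_absorb:
  fixes \<U> \<V> :: "'a::metric_space set set"
  assumes \<U>: "separated_family r D \<U>" and \<V>: "separated_family (3 * r + 2 * D) D' \<V>"
    and "r > 0" "D \<ge> 0" "D' \<ge> 0"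
  obtains \<W> where "\<Union>\<W> = \<Union>\<U> \<union> \<Union>\<V>" "separated_family r (D' + 2 * (r + D)) \<W>"
proof -
  define near where "near U V \<longleftrightarrow> (\<exists>u\<in>U. \<exists>v\<in>V. dist u v < r)" for U V :: "'a set"
  define absorb where "absorb V = V \<union> \<Union>{U\<in>\<U>. near U V}" for V
  define \<W> where "\<W> = absorb ` \<V> \<union> {U\<in>\<U>. \<forall>V\<in>\<V>. \<not> near U V}"
  have close: "\<exists>v\<in>V. dist x v \<le> r + D" if x: "x \<in> absorb V" for x V
  proof (cases "x \<in> V")
    case True
    then show ?thesis using assms(3,4) by (intro bexI[of _ x]) auto
  next
    case False
    then obtain U u v where "U \<in> \<U>" "x \<in> U" "u \<in> U" "v \<in> V" "dist u v < r"
      using x by (auto simp: absorb_def near_def)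
    moreover have "dist x u \<le> D" using separated_familyD(2)[OF \<U>] calculation by blast
    moreover have "dist x v \<le> dist x u + dist u v" by (rule dist_triangle)
    ultimately show ?thesis by (intro bexI[of _ v]) auto
  qed
  have tri: "dist v w \<le> dist x v + dist x y + dist y w" for v w x y :: 'a
    using dist_triangle[of v w x] dist_triangle[of x w y] by (simp add: dist_commute)
  \<comment> \<open>Either \<open>x\<close> lies in \<open>V\<close>, to which \<open>U\<close> is
    not near, or \<open>x\<close> lies in an absorbed \<open>U'\<close>; the latter is near
    \<open>V\<close>, hence differs from \<open>U\<close>, and the separation of \<open>\<U>\<close>
    applies.\<close>
  have far: "r \<le> dist x y"
    if xV: "x \<in> absorb V" and "V \<in> \<V>" "y \<in> U" "U \<in> \<U>" "\<forall>V\<in>\<V>. \<not> near U V" for x y U V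
  proof (cases "x \<in> V")
    case True
    then show ?thesis using that by (force simp: near_def dist_commute)
  next
    case False
    then obtain U' where U': "U' \<in> \<U>" "near U' V" "x \<in> U'" using xV by (auto simp: absorb_def)
    then have "U' \<noteq> U" using that by blast
    then show ?thesis using separated_familyD(1)[OF \<U>] U' that by blast
  qed
  show thesis
  proof (rule that)
    show "\<Union>\<W> = \<Union>\<U> \<union> \<Union>\<V>" by (auto simp: \<W>_def absorb_def)
    show "separated_family r (D' + 2 * (r + D)) \<W>"
      unfolding separated_family_def
    proof (intro conjI ballI impI)
      fix P Q x y assume PQ: "P \<in> \<W>" "Q \<in> \<W>" "P \<noteq> Q" and xy: "x \<in> P" "y \<in> Q"
      consider (VV) V W where "V \<in> \<V>" "W \<in> \<V>" "P = absorb V" "Q = absorb W"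
        | (VU) V where "V \<in> \<V>" "P = absorb V" "Q \<in> \<U>" "\<forall>V\<in>\<V>. \<not> near Q V"
        | (UV) V where "V \<in> \<V>" "Q = absorb V" "P \<in> \<U>" "\<forall>V\<in>\<V>. \<not> near P V"
        | (UU) "P \<in> \<U>" "Q \<in> \<U>"
        using PQ(1,2) unfolding \<W>_def by blast
      then show "r \<le> dist x y"
      proof cases
        case VV
        then obtain v w where vw: "v \<in> V" "dist x v \<le> r + D" "w \<in> W" "dist y w \<le> r + D"
          using close xy by meson
        have "V \<noteq> W" using VV PQ(3) by blast
        \<comment> \<open>Absorption moves each set outwards by at most \<open>r + D\<close>; of the
          separation \<open>3 * r + 2 * D\<close>, exactly \<open>r\<close> survives.\<close>
        then have "3 * r + 2 * D \<le> dist v w" using separated_familyD(1)[OF \<V>] VV vw by blast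
        with tri[of v w x y] vw show ?thesis by linarith
      next
        case VU
        then show ?thesis using far xy by blast
      next
        case UV
        then show ?thesis using far xy by (metis dist_commute)
      next
        case UU
        then show ?thesis using separated_familyD(1)[OF \<U>] PQ(3) xy by blast
      qed
    next
      fix P x y assume P: "P \<in> \<W>" and xy: "x \<in> P" "y \<in> P"
      show "dist x y \<le> D' + 2 * (r + D)"
      proof (cases "P \<in> \<U>")
        case True
        then have "dist x y \<le> D" using separated_familyD(2)[OF \<U>] xy by blast
        then show ?thesis using assms(3-5) by (simp add: algebra_simps)
      next
        case False
        then obtain V where V: "V \<in> \<V>" "P = absorb V" using P by (auto simp: \<W>_def)
        then obtain v w where vw: "v \<in> V" "dist x v \<le> r + D" "w \<in> V" "dist y w \<le> r + D"
          using close xy by meson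
        have "dist v w \<le> D'" using separated_familyD(2)[OF \<V>] V vw by blast
        with tri[of x y v w] vw show ?thesis by (simp add: dist_commute)
      qed
    qed
  qed
qed

text \<open>The families of equal colour are merged by absorption, so the number of colours does not
  grow. The order of choices matters: the separation for \<open>B\<close> depends on the diameter
  bound obtained for \<open>A\<close>.\<close>

lemma asdim_le_Un:
  fixes A B :: "'a::metric_space set"
  assumes "asdim_le A n" "asdim_le B n"
  shows "asdim_le (A \<union> B) n"
proof (rule coloured_imp_asdim_le)
  fix r :: real assume r: "r > 0"
  obtain D \<U> where \<U>: "(\<Union>i\<le>n. \<Union>(\<U> i)) = A" "\<And>i. i \<le> n \<Longrightarrow> separated_family r D (\<U> i)"
    by (rule asdim_le_imp_coloured[OF assms(1) r]) (rule that)
  \<comment> \<open>A diameter bound may be negative when all members are empty; absorption wants it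
    nonnegative.\<close>
  define D0 where "D0 = max D 0"
  have "3 * r + 2 * D0 > 0" using r by (simp add: D0_def)
  then obtain D' \<V> where \<V>: "(\<Union>i\<le>n. \<Union>(\<V> i)) = B"
    "\<And>i. i \<le> n \<Longrightarrow> separated_family (3 * r + 2 * D0) D' (\<V> i)"
    by (rule asdim_le_imp_coloured[OF assms(2)]) (rule that)
  define D1 where "D1 = max D' 0"
  have "\<exists>\<W>. \<Union>\<W> = \<Union>(\<U> i) \<union> \<Union>(\<V> i) \<and> separated_family r (D1 + 2 * (r + D0)) \<W>" if "i \<le> n" for i
  proof (rule separated_family_absorb)
    show "separated_family r D0 (\<U> i)"
      using \<U>(2)[OF that] unfolding separated_family_def D0_def by (meson max.coboundedI1)
    show "separated_family (3 * r + 2 * D0) D1 (\<V> i)"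
      using \<V>(2)[OF that] unfolding separated_family_def D1_def by (meson max.coboundedI1)
  qed (use r in \<open>auto simp: D0_def D1_def\<close>)
  then obtain \<W> where \<W>: "\<And>i. i \<le> n \<Longrightarrow> \<Union>(\<W> i) = \<Union>(\<U> i) \<union> \<Union>(\<V> i)"
    "\<And>i. i \<le> n \<Longrightarrow> separated_family r (D1 + 2 * (r + D0)) (\<W> i)"
    by metis
  have "(\<Union>i\<le>n. \<Union>(\<W> i)) = A \<union> B" using \<W>(1) \<U>(1) \<V>(1) by auto
  with \<W>(2) show "\<exists>D \<W>. (\<Union>i\<le>n. \<Union>(\<W> i)) = A \<union> B \<and> (\<forall>i\<le>n. separated_family r D (\<W> i))"
    by blast
qed

section \<open>Annuli strung on a ray\<close>

text \<open>Intermediate value theorem for the distance from \<open>x\<close>.\<close>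

lemma connected_unbounded_dist:
  fixes C :: "'a::metric_space set"
  assumes "connected C" "c \<in> C" "\<And>B. \<exists>y\<in>C. B < dist x y" "dist x c \<le> t"
  shows "\<exists>y\<in>C. dist x y = t"
proof -
  have "connected (dist x ` C)"
    by (intro connected_continuous_image continuous_intros assms)
  moreover obtain y where "y \<in> C" "t < dist x y" using assms(3) by blast
  ultimately have "t \<in> dist x ` C"
    using connectedD_interval[of "dist x ` C" "dist x c" "dist x y" t] assms(2,4) by auto
  then show ?thesis by auto
qed

text \<open>A deep component is unbounded, hence crosses every sufficiently large sphere about
  \<open>x\<close>. Where such a sphere meets \<open>Y\<close> in at most one point, two deep
  components share it and coincide.\<close>

lemma not_coarsely_separates_if_gaps:
  fixes Y :: "'a::metric_space set"
  assumes "connected Y"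
    and gaps: "\<And>B. \<exists>t\<ge>B. \<exists>p. \<forall>y\<in>Y. dist x y = t \<longrightarrow> y = p"
  shows "\<not> coarsely_separates Y K"
proof
  assume "coarsely_separates Y K"
  then obtain R C D where CD: "C \<in> components (Y - nbhd_in Y R K)" "D \<in> components (Y - nbhd_in Y R K)"
    "C \<noteq> D" "deep Y K C" "deep Y K D"
    unfolding coarsely_separates_def by blast
  show False
  proof (cases "K = {}")
    \<comment> \<open>By the convention in \<open>nbhd_in\<close> nothing is removed, and the
      connected set \<open>Y\<close> has no two components.\<close>
    case True
    then have "Y - nbhd_in Y R K = Y" by (auto simp: nbhd_in_def)
    then have "components (Y - nbhd_in Y R K) \<subseteq> {Y}"
      using assms(1) by (metis components_eq_sing_iff components_empty empty_subsetI order_refl)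
    with CD show False by blast
  next
    case False
    then obtain k where k: "k \<in> K" by blast
    have unbdd: "\<exists>y\<in>E. B < dist x y" if E: "deep Y K E" "E \<subseteq> Y" for E B
    proof (rule ccontr)
      assume "\<not> ?thesis"
      then have B: "dist x y \<le> B" if "y \<in> E" for y using that by force
      \<comment> \<open>A bounded \<open>E\<close> would lie in a finite neighbourhood of the single
        point \<open>k\<close>, against depth. The absolute value and the \<open>1\<close> keep the
        radius positive.\<close>
      let ?R = "\<bar>B\<bar> + dist x k + 1"
      have "E \<subseteq> nbhd_in Y ?R K"
      proof
        fix y assume y: "y \<in> E"
        have "infdist y K \<le> dist y k" using k by (rule infdist_le)
        also have "\<dots> \<le> dist x y + dist x k" by (metis dist_commute dist_triangle)
        also have "\<dots> \<le> ?R" using B[OF y] by linarith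
        finally show "y \<in> nbhd_in Y ?R K" using y E(2) False by (auto simp: nbhd_in_def)
      qed
      moreover have "?R > 0" using zero_le_dist[of x k] by linarith
      ultimately show False using E(1) unfolding deep_def by blast
    qed
    have sub: "C \<subseteq> Y" "D \<subseteq> Y" using CD(1,2) in_components_subset by blast+
    have conn: "connected C" "connected D" using CD(1,2) in_components_connected by blast+
    obtain c d where cd: "c \<in> C" "d \<in> D" using CD(1,2) in_components_nonempty by blast
    obtain t p where t: "max (dist x c) (dist x d) \<le> t" "\<forall>y\<in>Y. dist x y = t \<longrightarrow> y = p"
      using gaps by blast
    obtain y where "y \<in> C" "dist x y = t"
      using connected_unbounded_dist[OF conn(1) cd(1) unbdd[OF CD(4) sub(1)], of t] t(1) by auto
    moreover obtain z where "z \<in> D" "dist x z = t"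
      using connected_unbounded_dist[OF conn(2) cd(2) unbdd[OF CD(5) sub(2)], of t] t(1) by auto
    ultimately have "p \<in> C \<inter> D" using t(2) sub by blast
    then show False using components_eq[OF CD(1,2)] CD(3) by blast
  qed
qed

section \<open>Connectedness and position of the annuli\<close>

lemma isometric_on_continuous:
  assumes "isometric_on S g" shows "continuous_on S g"
  unfolding continuous_on_iff
proof (intro ballI allI impI)
  fix x e assume "x \<in> S" "(0::real) < e"
  then show "\<exists>d>0. \<forall>x'\<in>S. dist x' x < d \<longrightarrow> dist (g x') (g x) < e"
    using assms by (intro exI[of _ e]) (simp add: isometric_on_def)
qed

definition annulus :: "'a::metric_space set \<Rightarrow> 'a \<Rightarrow> real \<Rightarrow> real \<Rightarrow> 'a set" where
  "annulus X x a b = {y\<in>X. a \<le> dist x y \<and> dist x y \<le> b}"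

text \<open>The distance from \<open>x\<close> is 1-Lipschitz and equals \<open>a\<close> on the
  sphere. This keeps the added neighbourhoods from filling the gaps between annuli.\<close>

lemma nbhd_sphere_dist:
  assumes "y \<in> nbhd_in X R (X \<inter> sphere x a)"
  shows "\<bar>dist x y - a\<bar> \<le> R"
proof -
  have ne: "X \<inter> sphere x a \<noteq> {}" and le: "infdist y (X \<inter> sphere x a) \<le> R"
    using assms by (auto simp: nbhd_in_def)
  have "\<bar>dist x y - a\<bar> \<le> infdist y (X \<inter> sphere x a)"
    unfolding infdist_notempty[OF ne]
  proof (rule cINF_greatest[OF ne])
    fix z assume "z \<in> X \<inter> sphere x a"
    then show "\<bar>dist x y - a\<bar> \<le> dist y z"
      using dist_triangle[of x y z] dist_triangle[of x z y] by (auto simp: dist_commute)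
  qed
  with le show ?thesis by linarith
qed

text \<open>An annulus alone may be disconnected, but each of its points is joined inside it to the
  inner sphere by a radial geodesic, and the neighbourhood of that sphere is connected.\<close>

lemma connected_annulus_Un_nbhd:
  fixes X :: "'a::metric_space set"
  assumes geo: "geodesic_space X" and x: "x \<in> X" and "a \<ge> 0" "R > 0"
    and conn: "connected (nbhd_in X R (X \<inter> sphere x a))"
    and ne: "X \<inter> sphere x a \<noteq> {}"
  shows "connected (annulus X x a b \<union> nbhd_in X R (X \<inter> sphere x a))" (is "connected (_ \<union> ?N)")
proof -
  have sph: "X \<inter> sphere x a \<subseteq> ?N"
    using assms(4) by (auto simp: nbhd_in_def)
  have ex: "\<exists>T. connected T \<and> T \<subseteq> annulus X x a b \<and> y \<in> T \<and> T \<inter> ?N \<noteq> {}"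
    if y: "y \<in> annulus X x a b" for y
  proof -
    have yX: "y \<in> X" and d: "a \<le> dist x y" "dist x y \<le> b" using y by (auto simp: annulus_def)
    obtain g where g: "g 0 = x" "g (dist x y) = y" "g ` {0..dist x y} \<subseteq> X"
      "isometric_on {0..dist x y} g"
      using geo x yX unfolding geodesic_space_def by blast
    have dg: "dist x (g t) = t" if "0 \<le> t" "t \<le> dist x y" for t
    proof -
      have "dist (g 0) (g t) = dist 0 t" using g(4) that unfolding isometric_on_def by auto
      then show ?thesis using g(1) that by (simp add: dist_real_def)
    qed
    \<comment> \<open>Along \<open>g\<close> the distance from \<open>x\<close> equals the
      parameter, so starting at \<open>a\<close> cuts the geodesic at the inner sphere.\<close>
    let ?T = "g ` {a..dist x y}"
    have "continuous_on {a..dist x y} g"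
      using isometric_on_continuous[OF g(4)] by (rule continuous_on_subset) (use assms(3) in auto)
    then have "connected ?T" by (intro connected_continuous_image) auto
    moreover have "?T \<subseteq> annulus X x a b"
      using dg g(3) assms(3) d by (auto simp: annulus_def)
    moreover have "y \<in> ?T" using g(2) d by force
    moreover have "g a \<in> ?T \<inter> ?N"
      using sph dg[of a] d assms(3) g(3) by (auto simp: subset_iff)
    ultimately show ?thesis by blast
  qed
  \<comment> \<open>Each piece is enlarged by \<open>?N\<close>, which gives the pieces a common
    nonempty part.\<close>
  let ?\<T> = "{T \<union> ?N |T. connected T \<and> T \<subseteq> annulus X x a b \<and> T \<inter> ?N \<noteq> {}}"
  have N: "?N \<noteq> {}" using ne sph by blast
  have conn': "connected (\<Union>(insert ?N ?\<T>))"
  proof (rule connected_Union)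
    show "connected S" if "S \<in> insert ?N ?\<T>" for S
      using that conn by (auto intro: connected_Un)
    show "\<Inter>(insert ?N ?\<T>) \<noteq> {}" using N by blast
  qed
  have "\<Union>(insert ?N ?\<T>) = annulus X x a b \<union> ?N"
  proof (intro equalityI subsetI)
    fix y assume "y \<in> annulus X x a b \<union> ?N"
    then show "y \<in> \<Union>(insert ?N ?\<T>)"
    proof
      assume "y \<in> annulus X x a b"
      from ex[OF this] obtain T
        where T: "connected T" "T \<subseteq> annulus X x a b" "y \<in> T" "T \<inter> ?N \<noteq> {}"
        by (elim exE conjE) (rule that)
      then have "T \<union> ?N \<in> ?\<T>" by blast
      then show ?thesis using T(3) by (intro UnionI[of "T \<union> ?N"]) auto
    qed simp
  qed auto
  with conn' show ?thesis by (simp only:)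
qed

section \<open>Construction of the Cantor manifold\<close>

theorem theorem4p3:
  fixes X :: "'a::metric_space set" and n :: nat
  assumes "geodesic_space X"
    and "n \<ge> 2"
    and "asdim X = enat n"
    and "has_infinite_geodesic X"
    and "uniformly_coarse_connected_spheres X"
  shows "\<exists>Y\<subseteq>X. asymptotic_Cantor_manifold n Y"
proof -
  obtain m where n: "n = Suc m" using assms(2) by (cases n) auto
  then have X: "asdim_le X n" "\<not> asdim_le X m" using assms(3) asdim_eq_Suc_iff by blast+
  obtain g where g: "g ` {0..} \<subseteq> X" "isometric_on {0..} g"
    using assms(4) unfolding has_infinite_geodesic_def by blast
  obtain R where R: "R > 0" "\<And>x r. x \<in> X \<Longrightarrow> r \<ge> 0 \<Longrightarrow> connected (nbhd_in X R (X \<inter> sphere x r))"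
    using assms(5) unfolding uniformly_coarse_connected_spheres_def by blast
  define x where "x = g 0"
  have x: "x \<in> X" using g(1) by (auto simp: x_def)
  have dg: "dist x (g t) = t" if "t \<ge> 0" for t
  proof -
    have "dist (g 0) (g t) = dist 0 t" using g(2) that unfolding isometric_on_def by auto
    then show ?thesis using that by (simp add: dist_real_def x_def)
  qed
  \<comment> \<open>\<open>W\<close> is the width of both annuli and gaps. The neighbourhoods reach
    at most \<open>R\<close> into a gap, so its middle, \<open>2 * R\<close> from either side, stays
    free.\<close>
  define W where "W = 4 * R"
  have W: "W > 0" using R by (simp add: W_def)
  \<comment> \<open>The parity \<open>s\<close> selects every second annulus; the others become
    gaps.\<close>
  define a where "a s k = real (2 * k + s) * W" for s k :: nat
  have a0: "a s k \<ge> 0" for s k using W by (simp add: a_def)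
  define E where "E s = (\<Union>k. annulus X x (a s k) (a s k + W))" for s
  have "X \<subseteq> E 0 \<union> E 1"
  proof
    fix y assume y: "y \<in> X"
    define j where "j = nat \<lfloor>dist x y / W\<rfloor>"
    have "real j \<le> dist x y / W" "dist x y / W \<le> real j + 1"
      using W unfolding j_def by (auto simp: le_nat_floor)
    then have j: "real j * W \<le> dist x y" "dist x y \<le> real j * W + W"
      using W by (auto simp: field_simps)
    have "j = 2 * (j div 2) + 0 \<or> j = 2 * (j div 2) + 1" by presburger
    then have "real j * W = a 0 (j div 2) \<or> real j * W = a 1 (j div 2)"
      unfolding a_def by metis
    then show "y \<in> E 0 \<union> E 1" using y j by (auto simp: E_def annulus_def)
  qed
  then have "\<not> asdim_le (E 0 \<union> E 1) m" using X(2) asdim_le_subset by blast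
  then obtain s where s: "\<not> asdim_le (E s) m" using asdim_le_Un by blast
  define L where "L k = annulus X x (a s k) (a s k + W) \<union> nbhd_in X R (X \<inter> sphere x (a s k))" for k
  define Y where "Y = g ` {0..} \<union> (\<Union>k. L k)"
  \<comment> \<open>The ray meets every inner sphere, which makes these spheres nonempty and ties
    all pieces \<open>L k\<close> together.\<close>
  have sphere: "g (a s k) \<in> X \<inter> sphere x (a s k)" for k
    using dg[OF a0] g(1) a0 by auto
  have "Y \<subseteq> X" using g(1) by (auto simp: Y_def L_def annulus_def nbhd_in_def)
  moreover have conn: "connected Y"
  proof -
    have ray: "connected (g ` {0..})"
      using isometric_on_continuous[OF g(2)] by (intro connected_continuous_image) auto
    have "connected (L k)" for k
      unfolding L_def using sphere[of k]
      by (intro connected_annulus_Un_nbhd assms(1) x a0 R(1) R(2)) auto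
    moreover have "g (a s k) \<in> L k" for k
      using sphere[of k] W by (auto simp: L_def annulus_def)
    then have "g ` {0..} \<inter> L k \<noteq> {}" for k using a0[of s k] by force
    ultimately have "connected (g ` {0..} \<union> L k)" for k
      using ray by (intro connected_Un)
    then have "connected (\<Union>k. g ` {0..} \<union> L k)"
      by (intro connected_Union) auto
    moreover have "(\<Union>k. g ` {0..} \<union> L k) = Y" by (auto simp: Y_def)
    ultimately show ?thesis by simp
  qed
  \<comment> \<open>\<open>Y\<close> lies between \<open>E s\<close>, which has no bound
    \<open>m\<close>, and \<open>X\<close>.\<close>
  moreover have "asdim Y = enat n"
    unfolding n asdim_eq_Suc_iff
  proof
    show "asdim_le Y (Suc m)" using asdim_le_subset[OF X(1) \<open>Y \<subseteq> X\<close>] n by simp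
    have "E s \<subseteq> Y" by (auto simp: E_def Y_def L_def)
    then show "\<not> asdim_le Y m" using s asdim_le_subset by blast
  qed
  moreover have "\<not> coarsely_separates Y K" for K
  proof (rule not_coarsely_separates_if_gaps[OF conn])
    fix B :: real
    obtain k :: nat where "B / W < real k" using reals_Archimedean2 by blast
    then have B: "B \<le> real k * W" using W by (simp add: field_simps)
    \<comment> \<open>The middle of the gap after annulus \<open>k\<close>; there \<open>Y\<close>
      contains only the point \<open>g t\<close> of the ray.\<close>
    define t where "t = a s k + W + 2 * R"
    have "real k * W \<le> a s k" using W unfolding a_def by (intro mult_right_mono) auto
    then have "B \<le> t" using B W R(1) unfolding t_def by linarith
    moreover have "y = g t" if y: "y \<in> Y" "dist x y = t" for y
    proof -
      have "y \<notin> L j" for j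
      proof
        assume "y \<in> L j"
        then have le: "a s j - R \<le> t" "t \<le> a s j + W + R"
          using y(2) nbhd_sphere_dist[of y X R x "a s j"] R(1) W
          by (auto simp: L_def annulus_def)
        show False
        proof (cases "j \<le> k")
          case True
          then have "a s j \<le> a s k" using W unfolding a_def by (intro mult_right_mono) auto
          then show False using le R(1) by (simp add: t_def)
        next
          case False
          \<comment> \<open>The next annulus of the same parity starts \<open>2 * W\<close> after
            annulus \<open>k\<close>, and its neighbourhood reaches inwards only to
            \<open>a s k + W + 3 * R\<close>, beyond \<open>t\<close>.\<close>
          then have "real (2 * k + s + 2) * W \<le> a s j" using W unfolding a_def by (intro mult_right_mono) auto
          then have "a s k + 2 * W \<le> a s j" by (simp add: a_def algebra_simps)
          then show False using le R(1) by (simp add: t_def W_def)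
        qed
      qed
      then obtain u where "u \<ge> 0" "y = g u" using y(1) by (auto simp: Y_def)
      then show ?thesis using dg y(2) by auto
    qed
    ultimately show "\<exists>t\<ge>B. \<exists>p. \<forall>y\<in>Y. dist x y = t \<longrightarrow> y = p" by blast
  qed
  ultimately show ?thesis
    using assms(2) unfolding asymptotic_Cantor_manifold_def by blast
qed

end
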